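(* Let $(\mathbb{K},P)$ be an ordered field and $\mathbb{K}^c=\mathbb{K}(i)$, $i=\sqrt{-1}$. Let $V$ be a vector space of finite dimension $n$ over $\mathbb{K}^c$ with basis $e_1,\dots,e_n$, and let $\phi:V\times V\to\mathbb{K}^c$ be a non-negative definite hermitian form. Write $\phi_{jk}:=\phi(e_j,e_k)=a_{jk}+i\,b_{jk}$ with $a_{jk},b_{jk}\in\mathbb{K}$. Then: (i) $\phi_{11}\cdots\phi_{nn}\ge\det(a_{jk})\ge\det(\phi_{jk})$ and $\phi_{11}\cdots\phi_{nn}\ge\det(a_{jk})\ge\det(b_{jk})$. (ii) $\phi_{11}\cdots\phi_{nn}=\det(a_{jk})=\det(\phi_{jk})$ if and only if $\phi_{kk}=0$ for some $k$, or $(\phi_{jk})=(a_{jk})$ is diagonal. (iii) $\phi_{11}\cdots\phi_{nn}=\det(b_{jk})$ if and only if $\phi_{kk}=0$ for some $k$, or $(a_{jk})$ is diagonal and $\det(b_{jk})=\det(a_{jk})$.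
   Context: An ordered field $(\mathbb{K},P)$ is a field $\mathbb{K}$ with a subset $P$ (the positive elements) such that $0\notin P$, $P\cap -P=\emptyset$, $P+P\subset P$, $P\cdot P\subset P$, $\mathbb{K}=P\cup\{0\}\cup -P$; $a>b$ means $a-b\in P$, and $a\ge b$ means $a>b$ or $a=b$. Then $-1$ is not a sum of squares in $\mathbb{K}$, and $\mathbb{K}^c=\mathbb{K}+i\mathbb{K}$ carries the conjugation $\overline{x+iy}=x-iy$ ($x,y\in\mathbb{K}$). A hermitian form on $V$ is a map $\phi:V\times V\to\mathbb{K}^c$ that is conjugate-linear in the first argument, linear in the second argument, and satisfies $\overline{\phi(v,w)}=\phi(w,v)$. It is non-negative definite if $\phi(v,v)\ge 0$ for all $v\in V$. (The matrix $(a_{jk})$ is symmetric, $(b_{jk})$ is skew-symmetric, and $\det(\phi_{jk})$ and the $\phi_{kk}$ lie in $\mathbb{K}$.) *)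

theory Defs
  imports "Jordan_Normal_Form.Determinant" "Jordan_Normal_Form.Conjugate"
begin

text \<open>
  The ordered field \<open>K\<close> is a type of class \<open>linordered_field\<close>; its positive cone is
  \<open>P = {x. 0 < x}\<close>. The type \<open>'a kc\<close> is \<open>K(i) = K + iK\<close> as pairs of elements of \<open>K\<close>;
  \<open>kc_of\<close> is the inclusion of \<open>K\<close>.
\<close>

datatype 'a kc = Kc (kre: 'a) (kim: 'a)

definition kc_of :: "'a::zero \<Rightarrow> 'a kc" where
  "kc_of x = Kc x 0"

definition kc_i :: "'a::zero_neq_one kc" where
  "kc_i = Kc 0 1"

lemma kc_eq_iff: "z = w \<longleftrightarrow> kre z = kre w \<and> kim z = kim w"
  by (cases z; cases w) simp

instantiation kc :: (linordered_field) field
begin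

definition "0 = Kc 0 0"
definition "1 = Kc 1 0"
definition "z + w = Kc (kre z + kre w) (kim z + kim w)"
definition "- z = Kc (- kre z) (- kim z)"
definition "z - w = Kc (kre z - kre w) (kim z - kim w)"
definition "z * w = Kc (kre z * kre w - kim z * kim w) (kre z * kim w + kim z * kre w)"
definition "inverse z = Kc (kre z / ((kre z)\<^sup>2 + (kim z)\<^sup>2)) (- kim z / ((kre z)\<^sup>2 + (kim z)\<^sup>2))"
definition "z div w = z * inverse w" for z w :: "'a kc"

lemmas kc_ops_def = zero_kc_def one_kc_def plus_kc_def uminus_kc_def minus_kc_def
  times_kc_def inverse_kc_def divide_kc_def

instance
proof
  fix z :: "'a kc"
  assume "z \<noteq> 0"
  then have "(kre z)\<^sup>2 + (kim z)\<^sup>2 \<noteq> 0"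
    by (auto simp: kc_eq_iff kc_ops_def sum_power2_eq_zero_iff)
  then show "inverse z * z = 1"
    by (auto simp: kc_eq_iff kc_ops_def power2_eq_square add_divide_distrib[symmetric])
qed (auto simp: kc_eq_iff kc_ops_def algebra_simps)

end

text \<open>
  As for the complex numbers in \<open>HOL-Library.Complex_Order\<close>, the order of \<open>K\<close> is extended to
  a partial order on \<open>K(i)\<close>: \<open>z > w\<close> iff \<open>z - w \<in> P\<close>. In particular \<open>z \<ge> 0\<close> includes that
  \<open>z\<close> lies in \<open>K\<close>.
\<close>

instantiation kc :: (linordered_field) conjugatable_ordered_field
begin

definition "z \<le> w \<longleftrightarrow> kre z \<le> kre w \<and> kim z = kim w"
definition "z < w \<longleftrightarrow> kre z < kre w \<and> kim z = kim w"
definition "conjugate z = Kc (kre z) (- kim z)"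

instance
  by standard
    (auto simp: kc_eq_iff kc_ops_def less_eq_kc_def less_kc_def conjugate_kc_def algebra_simps)

end

lemma kc_decomp: "z = kc_of (kre z) + kc_i * kc_of (kim z)"
  by (simp add: kc_eq_iff kc_ops_def kc_of_def kc_i_def)

lemma kc_i_square: "kc_i * kc_i = - 1"
  by (simp add: kc_eq_iff kc_ops_def kc_i_def)

lemma kc_less_iff: "w < z \<longleftrightarrow> (\<exists>p>0. z - w = kc_of p)"
  by (auto simp: kc_eq_iff kc_ops_def kc_of_def less_kc_def)

text \<open>
  Bases are indexed from 0, like the matrices: \<open>e 0, \<dots>, e (n - 1)\<close>; the values of \<open>e\<close> from
  \<open>n\<close> on are irrelevant. The empty basis (\<open>n = 0\<close>) is allowed.
\<close>

context vector_space
begin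

definition ordered_basis :: "nat \<Rightarrow> (nat \<Rightarrow> 'b) \<Rightarrow> bool" where
  "ordered_basis n e \<longleftrightarrow>
     inj_on e {..<n} \<and> independent (e ` {..<n}) \<and> span (e ` {..<n}) = UNIV"

end

definition hermitian_form ::
  "('k::linordered_field kc \<Rightarrow> 'v::ab_group_add \<Rightarrow> 'v) \<Rightarrow> ('v \<Rightarrow> 'v \<Rightarrow> 'k kc) \<Rightarrow> bool" where
  "hermitian_form scale \<phi> \<longleftrightarrow>
     (\<forall>u v w. \<phi> (u + v) w = \<phi> u w + \<phi> v w) \<and>
     (\<forall>c v w. \<phi> (scale c v) w = conjugate c * \<phi> v w) \<and>
     (\<forall>v. Vector_Spaces.linear scale (*) (\<phi> v)) \<and>
     (\<forall>v w. conjugate (\<phi> v w) = \<phi> w v)"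

definition nonneg_definite :: "('v \<Rightarrow> 'v \<Rightarrow> 'k::linordered_field kc) \<Rightarrow> bool" where
  "nonneg_definite \<phi> \<longleftrightarrow> (\<forall>v. \<phi> v v \<ge> 0)"

end

theory Submission
  imports Defs
begin

text \<open>
  Everything rests on the factorization \<open>f = U\<^sup>* D U\<close> of a non-negative hermitian matrix, with
  \<open>U\<close> upper triangular with unit diagonal and \<open>D\<close> diagonal with entries \<open>d k \<ge> 0\<close>
  (\<open>psd_LDL\<close>). It uses only the field operations of \<open>K\<close>, so it needs neither square roots nor
  eigenvalues, and it is real when \<open>f\<close> is. Since \<open>det f = \<Prod> d k\<close> and
  \<open>f k k = d k + (\<Sum>l<k. d l * \<bar>u l k\<bar>\<^sup>2)\<close>, it yields Hadamard's inequality
  \<open>det f \<le> \<Prod> f k k\<close>; if all \<open>f k k\<close> are positive, equality forces \<open>U = 1\<close>, that is, \<open>f\<close> is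
  diagonal (\<open>hadamard\<close>).

  Write \<open>f = A + iB\<close> for the Gram matrix of the form. The real part \<open>A\<close> is again non-negative,
  so Hadamard's inequality for \<open>A\<close> compares \<open>det A\<close> with \<open>\<Prod> f k k\<close>. If \<open>A\<close> is
  singular, a real null vector \<open>v\<close> of \<open>A\<close> satisfies \<open>v\<^sup>* f v = 0\<close>; by non-negativity \<open>f v = 0\<close>,
  whence \<open>B v = 0\<close>, and \<open>det A\<close>, \<open>det B\<close> and \<open>det f\<close> all vanish
  (\<open>det_eq_0_of_det_kre_eq_0\<close>). If \<open>A\<close> is regular, the real factorization \<open>A = U\<^sup>T D U\<close> gives
  a real congruence of determinant 1 that turns \<open>A\<close> into \<open>D\<close>; this changes none of the three
  determinants, so one may assume that \<open>A = D\<close> is diagonal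
  (\<open>det_bounds_of_det_kre_nonzero\<close>). In that case (\<open>det_bounds_of_diagonal_kre\<close>):

  \<^item> \<open>D + iB\<close> has diagonal \<open>D\<close>, as \<open>B\<close> is skew, so Hadamard's inequality reads
    \<open>det f \<le> det A\<close>, and equality forces \<open>B = 0\<close>;
  \<^item> \<open>C = B\<^sup>T D\<^sup>-\<^sup>1 B\<close> is non-negative with \<open>C k k \<le> d k\<close>, so Hadamard's inequality for \<open>C\<close>
    gives \<open>(det B)\<^sup>2 \<le> (det A)\<^sup>2\<close>, and \<open>det A \<ge> 0\<close>.

  The equality cases follow: if some \<open>f k k\<close> is zero, every determinant in question vanishes, and
  otherwise they are the equality cases just described.
\<close>

section \<open>Arithmetic in \<open>K(i)\<close>\<close>

lemma kre_simps [simp]: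
  "kre 0 = 0" "kim 0 = 0" "kre 1 = 1" "kim 1 = 0"
  "kre (z + w) = kre z + kre w" "kim (z + w) = kim z + kim w"
  "kre (z - w) = kre z - kre w" "kim (z - w) = kim z - kim w"
  "kre (- z) = - kre z" "kim (- z) = - kim z"
  "kre (z * w) = kre z * kre w - kim z * kim w"
  "kim (z * w) = kre z * kim w + kim z * kre w"
  "kre (conjugate z) = kre z" "kim (conjugate z) = - kim z"
  for z w :: "'k::linordered_field kc"
  by (simp_all add: kc_ops_def conjugate_kc_def)

lemma kc_of_simps [simp]:
  "kre (kc_of x) = x" "kim (kc_of x) = 0" "kre kc_i = 0" "kim kc_i = 1"
  by (simp_all add: kc_of_def kc_i_def)

lemma kre_sum [simp]: "kre (sum f S) = (\<Sum>x\<in>S. kre (f x))"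
  and kim_sum [simp]: "kim (sum f S) = (\<Sum>x\<in>S. kim (f x))"
  for f :: "'b \<Rightarrow> 'k::linordered_field kc"
  by (induction S rule: infinite_finite_induct) auto

lemma conjugate_one [simp]: "conjugate 1 = (1 :: 'k::linordered_field kc)"
  by (simp add: kc_eq_iff)

lemma kc_of_le_iff [simp]: "kc_of x \<le> kc_of y \<longleftrightarrow> x \<le> y"
  by (simp add: less_eq_kc_def)

lemma kc_of_eq_iff [simp]: "kc_of x = kc_of y \<longleftrightarrow> x = y"
  by (simp add: kc_of_def)

interpretation kc_of_hom: comm_ring_hom "kc_of :: 'k::linordered_field \<Rightarrow> 'k kc"
  by unfold_locales (simp_all add: kc_eq_iff)

section \<open>Non-negative hermitian matrices\<close>

text \<open>
  Matrices are functions here, read on the indices below \<open>n\<close>: the steps of an elimination then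
  all have the same type and size.
\<close>

definition sesq :: "nat \<Rightarrow> (nat \<Rightarrow> nat \<Rightarrow> 'k::linordered_field kc) \<Rightarrow> (nat \<Rightarrow> 'k kc) \<Rightarrow> (nat \<Rightarrow> 'k kc) \<Rightarrow> 'k kc"
  where "sesq n f x y = (\<Sum>j<n. \<Sum>k<n. conjugate (x j) * f j k * y k)"

definition psd :: "nat \<Rightarrow> (nat \<Rightarrow> nat \<Rightarrow> 'k::linordered_field kc) \<Rightarrow> bool"
  where "psd n f \<longleftrightarrow>
    (\<forall>j<n. \<forall>k<n. conjugate (f j k) = f k j) \<and> (\<forall>x. 0 \<le> sesq n f x x)"

lemma psd_hermitian: "psd n f \<Longrightarrow> j < n \<Longrightarrow> k < n \<Longrightarrow> conjugate (f j k) = f k j"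
  by (simp add: psd_def)

text \<open>
  The combination \<open>x + t y\<close> covers additivity and compatibility with scalars at once.
\<close>

lemma sesq_linear_left:
  "sesq n f (\<lambda>k. x k + t * y k) z = sesq n f x z + conjugate t * sesq n f y z"
  by (simp add: sesq_def conjugate_dist_add conjugate_dist_mul algebra_simps
      sum.distrib sum_distrib_left)

lemma sesq_linear_right:
  "sesq n f z (\<lambda>k. x k + t * y k) = sesq n f z x + t * sesq n f z y"
  by (simp add: sesq_def algebra_simps sum.distrib sum_distrib_left)

lemma sesq_add_smult:
  "sesq n f (\<lambda>k. x k + t * y k) (\<lambda>k. x k + t * y k) =
   sesq n f x x + t * sesq n f x y + conjugate t * sesq n f y x + conjugate t * t * sesq n f y y"
  by (simp add: sesq_linear_left sesq_linear_right algebra_simps)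

lemma sesq_sum_left:
  fixes m :: nat shows
  "sesq n f (\<lambda>l. \<Sum>j<m. p j l * x j) z = (\<Sum>j<m. conjugate (x j) * sesq n f (p j) z)"
proof (induction m)
  case (Suc m)
  then show ?case
    using sesq_linear_left[of n f "\<lambda>l. \<Sum>j<m. p j l * x j" "x m" "p m" z]
    by (simp add: mult.commute)
qed (simp add: sesq_def)

lemma sesq_sum_right:
  fixes m :: nat shows
  "sesq n f z (\<lambda>l. \<Sum>j<m. p j l * x j) = (\<Sum>j<m. sesq n f z (p j) * x j)"
proof (induction m)
  case (Suc m)
  then show ?case
    using sesq_linear_right[of n f z "\<lambda>l. \<Sum>j<m. p j l * x j" "x m" "p m"]
    by (simp add: mult.commute)
qed (simp add: sesq_def)

lemma sesq_conjugate:
  assumes "\<And>j k. j < n \<Longrightarrow> k < n \<Longrightarrow> conjugate (f j k) = f k j"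
  shows "conjugate (sesq n f x y) = sesq n f y x"
proof -
  have "conjugate (sesq n f x y) = (\<Sum>j<n. \<Sum>k<n. x j * f k j * conjugate (y k))"
    by (simp add: sesq_def sum_conjugate conjugate_dist_mul assms)
  also have "\<dots> = (\<Sum>k<n. \<Sum>j<n. x j * f k j * conjugate (y k))"
    by (rule sum.swap)
  also have "\<dots> = sesq n f y x"
    by (simp add: sesq_def mult_ac)
  finally show ?thesis .
qed

lemma sesq_swap: "psd n f \<Longrightarrow> conjugate (sesq n f x y) = sesq n f y x"
  by (rule sesq_conjugate) (rule psd_hermitian)

text \<open>
  Only the real part has to be checked, since the values of a hermitian form on the diagonal are
  real.
\<close>

lemma psdI:
  assumes herm: "\<And>j k. j < n \<Longrightarrow> k < n \<Longrightarrow> conjugate (f j k) = f k j"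
    and nonneg: "\<And>x. 0 \<le> kre (sesq n f x x)"
  shows "psd n f"
proof -
  have "kim (sesq n f x x) = 0" for x
    using arg_cong[where f = kim, OF sesq_conjugate[where f = f and x = x and y = x, OF herm]]
    by auto
  then show ?thesis
    using assms by (auto simp: psd_def less_eq_kc_def)
qed

definition std_basis :: "nat \<Rightarrow> nat \<Rightarrow> 'k::linordered_field kc"
  where "std_basis j k = of_bool (k = j)"

lemma sum_std_basis [simp]: "m < n \<Longrightarrow> (\<Sum>k<n. g k * std_basis m k) = g m"
  by (simp add: std_basis_def of_bool_def if_distrib[of "\<lambda>t. _ * t"] sum.delta cong: if_cong)

lemma sesq_std_basis_left:
  assumes "m < n" shows "sesq n f (std_basis m) x = (\<Sum>k<n. f m k * x k)"
proof -
  have "sesq n f (std_basis m) x = (\<Sum>j<n. if j = m then (\<Sum>k<n. f m k * x k) else 0)"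
    unfolding sesq_def by (rule sum.cong) (auto simp: std_basis_def kc_eq_iff)
  then show ?thesis using assms by simp
qed

text \<open>
  With \<open>z = f(y, x)\<close> and \<open>c = f(y, y)\<close>, the value of the form at \<open>y - s (conjugate z) x\<close> is
  \<open>c - 2 s \<bar>z\<bar>\<^sup>2\<close> for every \<open>s \<in> K\<close>. If \<open>z \<noteq> 0\<close>, this becomes negative for large \<open>s\<close>.
\<close>

lemma psd_null:
  assumes "psd n f" and "sesq n f x x = 0"
  shows "sesq n f y x = 0"
proof (rule ccontr)
  assume nz: "sesq n f y x \<noteq> 0"
  define z where "z = sesq n f y x"
  define c where "c = kre (sesq n f y y)"
  define q where "q = (kre z)\<^sup>2 + (kim z)\<^sup>2"
  have q: "q > 0"
    using nz by (auto simp: q_def z_def[symmetric] kc_eq_iff sum_power2_gt_zero_iff)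
  \<comment> \<open>the scalar for which \<open>c - 2 s q\<close> equals \<open>-1\<close>\<close>
  define s where "s = (c + 1) / (2 * q)"
  have zc: "sesq n f x y = conjugate z"
    unfolding z_def using sesq_swap[OF assms(1)] by simp
  define t where "t = - kc_of s * conjugate z"
  have "0 \<le> kre (sesq n f (\<lambda>k. y k + t * x k) (\<lambda>k. y k + t * x k))"
    using assms(1) by (auto simp: psd_def less_eq_kc_def)
  also have "\<dots> = c - 2 * s * q"
    unfolding sesq_add_smult zc assms(2) z_def[symmetric]
    by (simp add: t_def c_def q_def power2_eq_square algebra_simps)
  also have "\<dots> = -1" using q by (simp add: s_def field_simps)
  finally show False by simp
qed

text \<open>
  One step of Gaussian elimination. Subtracting the rank one matrix \<open>w\<^sup>* c w\<close> clears row and column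
  \<open>m\<close> and keeps the matrix non-negative, because the new form at \<open>x\<close> is the old form at
  \<open>x - s e\<^sub>m\<close> for \<open>s = \<Sum> w k * x k\<close>. A zero pivot does no harm: by \<open>psd_null\<close> the whole row is
  then zero. The clauses on zero and on real entries of row \<open>m\<close> carry the triangular shape and
  the reality of \<open>U\<close> through the elimination in \<open>psd_LDL\<close>.
\<close>

lemma psd_pivot:
  assumes f: "psd n f" and m: "m < n"
  obtains c w where "0 \<le> c" "w m = 1" "\<And>k. k < n \<Longrightarrow> f m k = kc_of c * w k"
    "\<And>k. k \<noteq> m \<Longrightarrow> f m k = 0 \<Longrightarrow> w k = 0"
    "\<And>k. kim (f m k) = 0 \<Longrightarrow> kim (w k) = 0"
    "psd n (\<lambda>j k. f j k - conjugate (w j) * kc_of c * w k)"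
proof -
  define c where "c = kre (f m m)"
  define w where "w k = (if k = m then 1 else if c = 0 then 0 else kc_of (1 / c) * f m k)" for k
  have diag: "sesq n f (std_basis m) (std_basis m) = f m m"
    using m by (simp add: sesq_std_basis_left)
  have fmm: "f m m = kc_of c" and c: "0 \<le> c"
    using f diag unfolding psd_def c_def
    by (metis kc_eq_iff kc_of_simps(1,2) less_eq_kc_def kre_simps(1,2))+
  have row0: "f m k = 0" if "c = 0" "k < n" for k
  proof -
    have "sesq n f (std_basis k) (std_basis m) = 0"
      using psd_null[OF f] diag fmm that by simp
    then have "f k m = 0" using that m by (simp add: sesq_std_basis_left)
    then show ?thesis using psd_hermitian[OF f that(2) m] by (metis conjugate_zero)
  qed
  have fw: "f m k = kc_of c * w k" if "k < n" for k
    using row0 that fmm by (auto simp: w_def kc_eq_iff)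
  have "psd n (\<lambda>j k. f j k - conjugate (w j) * kc_of c * w k)"
  proof (rule psdI)
    fix j k assume "j < n" "k < n"
    then show "conjugate (f j k - conjugate (w j) * kc_of c * w k) =
        f k j - conjugate (w k) * kc_of c * w j"
      using psd_hermitian[OF f, of j k] by (auto simp: kc_eq_iff)
  next
    fix x
    define s where "s = (\<Sum>k<n. w k * x k)"
    have "(\<Sum>j<n. \<Sum>k<n. conjugate (x j) * (conjugate (w j) * kc_of c * w k) * x k)
        = conjugate s * kc_of c * s"
      unfolding s_def
      by (simp add: sum_conjugate conjugate_dist_mul sum_distrib_left sum_distrib_right mult_ac)
    then have eq: "sesq n (\<lambda>j k. f j k - conjugate (w j) * kc_of c * w k) x x
        = sesq n f x x - conjugate s * kc_of c * s"
      by (simp add: sesq_def left_diff_distrib right_diff_distrib sum_subtractf)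
    have l: "sesq n f (std_basis m) x = kc_of c * s"
      using m by (simp add: sesq_std_basis_left fw s_def sum_distrib_left mult.assoc)
    have r: "sesq n f x (std_basis m) = kc_of c * conjugate s"
      using sesq_swap[OF f, of "std_basis m" x] by (auto simp: l kc_eq_iff)
    have "0 \<le> kre (sesq n f (\<lambda>k. x k + (- s) * std_basis m k) (\<lambda>k. x k + (- s) * std_basis m k))"
      using f by (auto simp: psd_def less_eq_kc_def)
    also have "\<dots> = kre (sesq n f x x - conjugate s * kc_of c * s)"
      unfolding sesq_add_smult l r diag fmm by (simp add: algebra_simps)
    finally show "0 \<le> kre (sesq n (\<lambda>j k. f j k - conjugate (w j) * kc_of c * w k) x x)"
      by (simp only: eq)
  qed
  then show ?thesis
    using c fw by (intro that[of c w]) (auto simp: w_def)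
qed

section \<open>Triangular factorization and Hadamard's inequality\<close>

text \<open>
  The remainder \<open>r m\<close> after \<open>m\<close> elimination steps is non-negative, its rows of index less than
  \<open>m\<close> are zero, and by symmetry so are its columns of index less than \<open>m\<close>. The pivot row \<open>w\<close> of the next step is therefore zero
  to the left of the diagonal, which makes \<open>U\<close> triangular.
\<close>

lemma psd_LDL:
  assumes f: "psd n f"
  obtains d u where
    "\<And>l. l < n \<Longrightarrow> 0 \<le> d l"
    "\<And>l. l < n \<Longrightarrow> u l l = 1"
    "\<And>l k. l < n \<Longrightarrow> k < l \<Longrightarrow> u l k = 0"
    "\<And>j k. j < n \<Longrightarrow> k < n \<Longrightarrow> f j k = (\<Sum>l<n. conjugate (u l j) * kc_of (d l) * u l k)"
    "\<And>l k. (\<And>j k. j < n \<Longrightarrow> k < n \<Longrightarrow> kim (f j k) = 0) \<Longrightarrow> l < n \<Longrightarrow> k < n \<Longrightarrow> kim (u l k) = 0"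
proof -
  define r where
    "r m u d j k = f j k - (\<Sum>l<m. conjugate (u l j) * kc_of (d l) * u l k)" for m :: nat and u d j k
  define real_f where "real_f \<longleftrightarrow> (\<forall>j<n. \<forall>k<n. kim (f j k) = 0)"
  have "\<exists>u d. (\<forall>l<m. 0 \<le> d l \<and> u l l = 1 \<and> (\<forall>k<l. u l k = 0)) \<and>
      (real_f \<longrightarrow> (\<forall>l<m. \<forall>k<n. kim (u l k) = 0)) \<and>
      psd n (r m u d) \<and> (\<forall>j<m. \<forall>k<n. r m u d j k = 0)"
    if "m \<le> n" for m
    using that
  proof (induction m)
    case 0
    then show ?case using f by (auto simp: r_def)
  next
    case (Suc m)
    from Suc.IH[OF Suc_leD[OF Suc.prems]] obtain u d where
      ud: "\<And>l. l < m \<Longrightarrow> 0 \<le> d l \<and> u l l = 1 \<and> (\<forall>k<l. u l k = 0)"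
      and re: "real_f \<longrightarrow> (\<forall>l<m. \<forall>k<n. kim (u l k) = 0)"
      and psd: "psd n (r m u d)"
      and zero: "\<And>j k. j < m \<Longrightarrow> k < n \<Longrightarrow> r m u d j k = 0"
      by blast
    have m: "m < n" using Suc.prems by simp
    obtain c w where wc: "0 \<le> c" "w m = 1" "\<And>k. k < n \<Longrightarrow> r m u d m k = kc_of c * w k"
      "\<And>k. k \<noteq> m \<Longrightarrow> r m u d m k = 0 \<Longrightarrow> w k = 0"
      "\<And>k. kim (r m u d m k) = 0 \<Longrightarrow> kim (w k) = 0"
      "psd n (\<lambda>j k. r m u d j k - conjugate (w j) * kc_of c * w k)"
      by (rule psd_pivot[OF psd m]) (rule that)
    have w0: "w j = 0" if "j < m" for j
    proof -
      have "conjugate (r m u d j m) = r m u d m j"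
        using psd_hermitian[OF psd, of j m] that m by simp
      then show ?thesis using zero[OF that m] wc(4)[of j] that by simp
    qed
    define u' where "u' = u(m := w)"
    define d' where "d' = d(m := c)"
    have step: "r (Suc m) u' d' = (\<lambda>j k. r m u d j k - conjugate (w j) * kc_of c * w k)"
      by (intro ext) (simp add: r_def u'_def d'_def diff_diff_eq)
    have "real_f \<Longrightarrow> k < n \<Longrightarrow> kim (w k) = 0" for k
      using wc(5)[of k] m re by (auto simp: r_def real_f_def)
    then have "real_f \<longrightarrow> (\<forall>l<Suc m. \<forall>k<n. kim (u' l k) = 0)"
      using re by (auto simp: u'_def less_Suc_eq)
    moreover have "\<forall>l<Suc m. 0 \<le> d' l \<and> u' l l = 1 \<and> (\<forall>k<l. u' l k = 0)"
      using ud wc(1,2) w0 by (auto simp: u'_def d'_def less_Suc_eq)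
    moreover have "\<forall>j<Suc m. \<forall>k<n. r (Suc m) u' d' j k = 0"
      unfolding step using zero w0 wc(2,3) by (auto simp: less_Suc_eq)
    ultimately show ?case
      using wc(6) unfolding step[symmetric] by blast
  qed
  from this[of n] obtain u d where
    ud: "\<And>l. l < n \<Longrightarrow> 0 \<le> d l \<and> u l l = 1 \<and> (\<forall>k<l. u l k = 0)"
    and re: "real_f \<longrightarrow> (\<forall>l<n. \<forall>k<n. kim (u l k) = 0)"
    and zero: "\<And>j k. j < n \<Longrightarrow> k < n \<Longrightarrow> r n u d j k = 0"
    by blast
  show ?thesis
    by (rule that[of d u]) (use ud re zero in \<open>auto simp: r_def real_f_def\<close>)
qed

text \<open>
  The left factor is an independent \<open>v\<close> so that the lemma serves both \<open>U\<^sup>* D U\<close>, with \<open>v\<close> the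
  conjugate of \<open>u\<close>, and the real case \<open>U\<^sup>T D U\<close>.
\<close>

lemma det_LDL:
  fixes u v :: "nat \<Rightarrow> nat \<Rightarrow> 'a::comm_ring_1"
  assumes "\<And>l. l < n \<Longrightarrow> u l l = 1" "\<And>l k. l < n \<Longrightarrow> k < l \<Longrightarrow> u l k = 0"
    and "\<And>l. l < n \<Longrightarrow> v l l = 1" "\<And>l k. l < n \<Longrightarrow> k < l \<Longrightarrow> v l k = 0"
    and "\<And>j k. j < n \<Longrightarrow> k < n \<Longrightarrow> f j k = (\<Sum>l<n. v l j * d l * u l k)"
  shows "det (mat n n (\<lambda>(j, k). f j k)) = (\<Prod>l<n. d l)"
proof -
  let ?L = "mat n n (\<lambda>(j, l). v l j)" and ?R = "mat n n (\<lambda>(l, k). d l * u l k)"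
  have "mat n n (\<lambda>(j, k). f j k) = ?L * ?R"
    by (rule eq_matI) (auto simp: scalar_prod_def assms(5) mult.assoc atLeast0LessThan)
  moreover have "det (?L * ?R) = det ?L * det ?R"
    by (rule det_mult) auto
  moreover have "det ?L = 1"
    by (subst det_lower_triangular[of n]) (auto simp: assms prod_list_diag_prod)
  moreover have "det ?R = (\<Prod>l<n. d l)"
    by (subst det_upper_triangular[of _ n])
      (auto simp: assms prod_list_diag_prod upper_triangular_def atLeast0LessThan)
  ultimately show ?thesis by simp
qed

lemma prod_eq_imp_factors_eq:
  fixes d g :: "nat \<Rightarrow> 'k::linordered_field"
  assumes "\<And>k. k < n \<Longrightarrow> 0 \<le> d k \<and> d k \<le> g k" "\<And>k. k < n \<Longrightarrow> 0 < g k"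
    and "(\<Prod>k<n. d k) = (\<Prod>k<n. g k)" "k < n"
  shows "d k = g k"
proof (rule ccontr)
  assume "d k \<noteq> g k"
  with assms have "d k < g k" by (simp add: order_less_le)
  have "(\<Prod>j<n. d j) = d k * (\<Prod>j\<in>{..<n} - {k}. d j)"
    using assms(4) by (simp add: prod.remove)
  also have "\<dots> \<le> d k * (\<Prod>j\<in>{..<n} - {k}. g j)"
    using assms by (intro mult_left_mono prod_mono) auto
  also have "\<dots> < g k * (\<Prod>j\<in>{..<n} - {k}. g j)"
    using assms(2) \<open>d k < g k\<close> by (intro mult_strict_right_mono prod_pos) auto
  also have "\<dots> = (\<Prod>j<n. g j)"
    using assms(4) by (simp add: prod.remove)
  finally show False using assms(3) by simp
qed

text \<open>
  In the factorization, \<open>f k k = (\<Sum>l<n. d l * \<bar>u l k\<bar>\<^sup>2)\<close> contains the term \<open>d k\<close>, and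
  \<open>det f = \<Prod> d k\<close>. If the products agree and all \<open>f k k\<close> are positive, then \<open>d k = f k k > 0\<close> for
  each \<open>k\<close>, so the remaining terms vanish and \<open>U\<close> is the identity.
\<close>

lemma hadamard:
  assumes f: "psd n f"
  shows "det (mat n n (\<lambda>(j, k). f j k)) \<le> (\<Prod>k<n. f k k)" (is ?le)
    and "0 \<le> det (mat n n (\<lambda>(j, k). f j k))" (is ?pos)
    and "det (mat n n (\<lambda>(j, k). f j k)) = (\<Prod>k<n. f k k) \<Longrightarrow> (\<And>k. k < n \<Longrightarrow> f k k \<noteq> 0) \<Longrightarrow>
      j < n \<Longrightarrow> k < n \<Longrightarrow> j \<noteq> k \<Longrightarrow> f j k = 0" (is "PROP ?eq")
proof -
  obtain u d where d: "\<And>l. l < n \<Longrightarrow> 0 \<le> d l"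
    and u1: "\<And>l. l < n \<Longrightarrow> u l l = 1" and u0: "\<And>l k. l < n \<Longrightarrow> k < l \<Longrightarrow> u l k = 0"
    and fu: "\<And>j k. j < n \<Longrightarrow> k < n \<Longrightarrow> f j k = (\<Sum>l<n. conjugate (u l j) * kc_of (d l) * u l k)"
    by (rule psd_LDL[OF f]) blast
  have det: "det (mat n n (\<lambda>(j, k). f j k)) = kc_of (\<Prod>l<n. d l)"
    unfolding kc_of_hom.hom_prod
    by (rule det_LDL[where v = "\<lambda>l k. conjugate (u l k)", OF u1 u0 _ _ fu])
      (auto simp: u1 u0 kc_eq_iff)
  define g where "g k = (\<Sum>l<n. d l * ((kre (u l k))\<^sup>2 + (kim (u l k))\<^sup>2))" for k
  have fg: "f k k = kc_of (g k)" if "k < n" for k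
    using that by (auto simp: fu kc_eq_iff g_def power2_eq_square algebra_simps)
  have g_split: "g k = d k + (\<Sum>l\<in>{..<n} - {k}. d l * ((kre (u l k))\<^sup>2 + (kim (u l k))\<^sup>2))"
    if "k < n" for k
    using that by (simp add: g_def sum.remove u1)
  have rest: "0 \<le> d l * ((kre (u l k))\<^sup>2 + (kim (u l k))\<^sup>2)" if "l < n" for l k
    using d[OF that] by simp
  have dg: "d k \<le> g k" if "k < n" for k
    unfolding g_split[OF that] using sum_nonneg[of "{..<n} - {k}", OF rest] by simp
  have prod: "(\<Prod>k<n. f k k) = kc_of (\<Prod>k<n. g k)"
    by (simp add: kc_of_hom.hom_prod fg)
  show ?le unfolding det prod kc_of_le_iff
    using d dg by (intro prod_mono) auto
  show ?pos unfolding det kc_of_hom.hom_zero[symmetric] kc_of_le_iff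
    using d by (intro prod_nonneg) auto
  assume eq: "det (mat n n (\<lambda>(j, k). f j k)) = (\<Prod>k<n. f k k)"
    and nz: "\<And>k. k < n \<Longrightarrow> f k k \<noteq> 0" and j: "j < n" and k: "k < n" and jk: "j \<noteq> k"
  have gpos: "0 < g k" if "k < n" for k
    using nz[OF that] fg[OF that] dg[OF that] d[OF that] by (force simp: order_less_le)
  have pe: "(\<Prod>k<n. d k) = (\<Prod>k<n. g k)"
    using eq unfolding det prod kc_of_eq_iff .
  have deq: "d k = g k" if "k < n" for k
    by (rule prod_eq_imp_factors_eq[of n]) (use d dg gpos pe that in auto)
  have u: "u l k = 0" if "l < n" "k < n" "l \<noteq> k" for l k
  proof -
    have "(\<Sum>l\<in>{..<n} - {k}. d l * ((kre (u l k))\<^sup>2 + (kim (u l k))\<^sup>2)) = 0"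
      using g_split[of k] deq[of k] that by simp
    then have "d l * ((kre (u l k))\<^sup>2 + (kim (u l k))\<^sup>2) = 0"
      using that rest by (subst (asm) sum_nonneg_eq_0_iff) auto
    moreover have "d l \<noteq> 0" using deq gpos that by fastforce
    ultimately show ?thesis by (simp add: kc_eq_iff sum_power2_eq_zero_iff)
  qed
  show "f j k = 0"
    unfolding fu[OF j k]
  proof (rule sum.neutral, safe)
    fix l assume "l < n"
    then show "conjugate (u l j) * kc_of (d l) * u l k = 0"
      using u[of l j] u[of l k] j k jk by (cases "l = k") (auto simp: u1)
  qed
qed

section \<open>Constructions of non-negative matrices\<close>

lemma psd_gram:
  assumes "psd n f"
  shows "psd m (\<lambda>j k. sesq n f (p j) (p k))"
proof (rule psdI)
  show "conjugate (sesq n f (p j) (p k)) = sesq n f (p k) (p j)" for j k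
    by (rule sesq_swap[OF assms])
  fix x
  have "sesq m (\<lambda>j k. sesq n f (p j) (p k)) x x
      = sesq n f (\<lambda>l. \<Sum>j<m. p j l * x j) (\<lambda>l. \<Sum>j<m. p j l * x j)"
    by (simp add: sesq_sum_left sesq_sum_right sesq_def[of m] sum_distrib_left mult.assoc)
  then show "0 \<le> kre (sesq m (\<lambda>j k. sesq n f (p j) (p k)) x x)"
    using assms by (simp add: psd_def less_eq_kc_def)
qed

lemma sesq_kc_of:
  "sesq n f (\<lambda>j. kc_of (s j)) (\<lambda>j. kc_of (t j)) =
   Kc (\<Sum>j<n. \<Sum>k<n. s j * kre (f j k) * t k) (\<Sum>j<n. \<Sum>k<n. s j * kim (f j k) * t k)"
  by (simp add: sesq_def kc_eq_iff)

text \<open>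
  For \<open>x = s + it\<close> the symmetric real part \<open>A\<close> takes the value \<open>A(s, s) + A(t, t)\<close> at \<open>x\<close>, and
  \<open>A(s, s)\<close> is the real part of \<open>f(s, s)\<close> for a real vector \<open>s\<close>.
\<close>

lemma psd_kre:
  assumes f: "psd n f"
  shows "psd n (\<lambda>j k. kc_of (kre (f j k)))"
proof (rule psdI)
  fix j k assume "j < n" "k < n"
  then show "conjugate (kc_of (kre (f j k))) = kc_of (kre (f k j))"
    using psd_hermitian[OF f, of j k] by (auto simp: kc_eq_iff)
next
  fix x
  have nonneg: "0 \<le> (\<Sum>j<n. \<Sum>k<n. s j * kre (f j k) * s k)" for s
  proof -
    have "0 \<le> sesq n f (\<lambda>j. kc_of (s j)) (\<lambda>j. kc_of (s j))"
      using f by (simp add: psd_def)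
    then show ?thesis by (simp add: sesq_kc_of less_eq_kc_def)
  qed
  have "kre (sesq n (\<lambda>j k. kc_of (kre (f j k))) x x) =
      (\<Sum>j<n. \<Sum>k<n. kre (x j) * kre (f j k) * kre (x k)) +
      (\<Sum>j<n. \<Sum>k<n. kim (x j) * kre (f j k) * kim (x k))"
    by (simp add: sesq_def sum.distrib)
  then show "0 \<le> kre (sesq n (\<lambda>j k. kc_of (kre (f j k))) x x)"
    using nonneg[of "\<lambda>j. kre (x j)"] nonneg[of "\<lambda>j. kim (x j)"] by simp
qed

lemma sesq_diagonal:
  "sesq n (\<lambda>j k. if j = k then \<delta> j else 0) x y = (\<Sum>l<n. conjugate (x l) * \<delta> l * y l)"
  by (simp add: sesq_def if_distrib[of "\<lambda>t. _ * t"] if_distrib[of "\<lambda>t. t * _"] cong: if_cong)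

lemma psd_diagonal:
  assumes "\<And>l. l < n \<Longrightarrow> 0 \<le> d l"
  shows "psd n (\<lambda>j k. if j = k then kc_of (d j) else 0)"
proof (rule psdI)
  fix x
  have "0 \<le> (\<Sum>l<n. d l * ((kre (x l))\<^sup>2 + (kim (x l))\<^sup>2))"
    using assms by (intro sum_nonneg) auto
  also have "\<dots> = kre (sesq n (\<lambda>j k. if j = k then kc_of (d j) else 0) x x)"
    by (simp add: sesq_diagonal power2_eq_square algebra_simps)
  finally show "0 \<le> kre (sesq n (\<lambda>j k. if j = k then kc_of (d j) else 0) x x)" .
qed (simp add: kc_eq_iff)

section \<open>Comparing the matrix with its real and imaginary parts\<close>

lemma det_kc_of: "det (mat n n (\<lambda>(j, k). kc_of (a j k))) = kc_of (det (mat n n (\<lambda>(j, k). a j k)))"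
proof -
  have "mat n n (\<lambda>(j, k). kc_of (a j k)) = map_mat kc_of (mat n n (\<lambda>(j, k). a j k))"
    by (rule eq_matI) auto
  then show ?thesis by simp
qed

text \<open>
  Links the two descriptions of a congruence: the Gram matrix of the columns of \<open>P\<close>, which
  \<open>psd_gram\<close> shows to be non-negative, and the matrix product, whose determinant is known.
\<close>

lemma congruence_mat:
  fixes f :: "nat \<Rightarrow> nat \<Rightarrow> 'a::comm_ring_1"
  assumes P: "P \<in> carrier_mat n n"
  shows "mat n n (\<lambda>(j, k). \<Sum>l<n. \<Sum>i<n. P $$ (l, j) * f l i * P $$ (i, k)) =
    P\<^sup>T * (mat n n (\<lambda>(j, k). f j k) * P)"
  using P by (intro eq_matI)
    (auto simp: scalar_prod_def sum_distrib_left mult.assoc atLeast0LessThan)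

text \<open>
  Here \<open>g = D + iB\<close> with \<open>B\<close> skew, so \<open>g\<close> has diagonal \<open>D\<close>; the first two claims are Hadamard's
  inequality for \<open>g\<close> with its equality case. The third is Hadamard's inequality for
  \<open>C = B\<^sup>T D\<^sup>-\<^sup>1 B\<close>, whose determinant is \<open>(det B)\<^sup>2 / \<Prod> d k\<close>. The bound \<open>C k k \<le> d k\<close> needed
  there comes from evaluating \<open>g\<close> at \<open>e\<^sub>k - i D\<^sup>-\<^sup>1 B e\<^sub>k\<close>, where it is
  \<open>d k - 2 C k k + C k k\<close>.
\<close>

lemma det_bounds_of_diagonal_kre:
  assumes g: "psd n g"
    and re: "\<And>j k. j < n \<Longrightarrow> k < n \<Longrightarrow> kre (g j k) = (if j = k then d j else 0)"
    and d: "\<And>j. j < n \<Longrightarrow> 0 < d j"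
  shows "det (mat n n (\<lambda>(j, k). g j k)) \<le> kc_of (\<Prod>k<n. d k)"
    and "det (mat n n (\<lambda>(j, k). g j k)) = kc_of (\<Prod>k<n. d k) \<Longrightarrow> j < n \<Longrightarrow> k < n \<Longrightarrow>
      kim (g j k) = 0"
    and "(det (mat n n (\<lambda>(j, k). kim (g j k))))\<^sup>2 \<le> (\<Prod>k<n. d k)\<^sup>2"
proof -
  have im: "kim (g k j) = - kim (g j k)" if "j < n" "k < n" for j k
    using psd_hermitian[OF g that] by (auto simp: kc_eq_iff)
  have diag: "g k k = kc_of (d k)" if "k < n" for k
    using re[OF that that] im[OF that that] by (simp add: kc_eq_iff)
  have prod: "(\<Prod>k<n. g k k) = kc_of (\<Prod>k<n. d k)"
    by (simp add: kc_of_hom.hom_prod diag)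
  show "det (mat n n (\<lambda>(j, k). g j k)) \<le> kc_of (\<Prod>k<n. d k)"
    using hadamard(1)[OF g] by (simp only: prod)
  show "kim (g j k) = 0"
    if "det (mat n n (\<lambda>(j, k). g j k)) = kc_of (\<Prod>k<n. d k)" and "j < n" "k < n"
  proof (cases "j = k")
    case True
    then show ?thesis using diag that by simp
  next
    case False
    have "g i i \<noteq> 0" if "i < n" for i
      using diag[OF that] d[OF that] by (simp add: kc_eq_iff)
    moreover have "det (mat n n (\<lambda>(j, k). g j k)) = (\<Prod>k<n. g k k)"
      using that(1) by (simp only: prod)
    ultimately have "g j k = 0"
      using hadamard(3)[OF g _ _ that(2,3) False] by blast
    then show ?thesis by simp
  qed
  define c where "c j k = (\<Sum>l<n. kim (g l j) * (1 / d l * kim (g l k)))" for j k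
  have "psd n (\<lambda>j k. sesq n (\<lambda>j k. if j = k then kc_of (1 / d j) else 0)
      (\<lambda>l. kc_of (kim (g l j))) (\<lambda>l. kc_of (kim (g l k))))"
    using d by (intro psd_gram psd_diagonal) (simp add: less_imp_le)
  also have "(\<lambda>j k. sesq n (\<lambda>j k. if j = k then kc_of (1 / d j) else 0)
      (\<lambda>l. kc_of (kim (g l j))) (\<lambda>l. kc_of (kim (g l k)))) = (\<lambda>j k. kc_of (c j k))"
    by (intro ext) (simp add: sesq_diagonal c_def kc_eq_iff)
  finally have c: "psd n (\<lambda>j k. kc_of (c j k))" .
  have c0: "0 \<le> c k k" for k
    unfolding c_def using d by (intro sum_nonneg) (simp add: less_imp_le)
  have cd: "c k k \<le> d k" if k: "k < n" for k
  proof -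
    define r where "r l = kim (g l k) / d l" for l
    define y where "y l = (kc_of (r l) :: 'a kc)" for l
    have *: "(\<Sum>i<n. kim (g k i) * r i) = - c k k"
      unfolding c_def sum_negf[symmetric] r_def
      by (rule sum.cong) (auto simp: im[of _ k] k)
    have l: "sesq n g (std_basis k) y = (\<Sum>i<n. g k i * y i)"
      using k by (rule sesq_std_basis_left)
    have "sesq n g y (std_basis k) = conjugate (\<Sum>i<n. g k i * y i)"
      using sesq_swap[OF g, of "std_basis k" y] l by simp
    moreover have "kre (sesq n g y y) = c k k"
    proof -
      have "kre (sesq n g y y) = (\<Sum>j<n. \<Sum>i<n. r j * kre (g j i) * r i)"
        unfolding y_def by (simp add: sesq_kc_of)
      also have "\<dots> = (\<Sum>j<n. \<Sum>i<n. if j = i then r j * d j * r j else 0)"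
        by (intro sum.cong refl) (auto simp: re)
      also have "\<dots> = c k k"
        unfolding c_def using d by (auto intro!: sum.cong simp: r_def less_imp_neq)
      finally show ?thesis .
    qed
    moreover have "sesq n g (std_basis k) (std_basis k) = kc_of (d k)"
      using k by (simp add: sesq_std_basis_left diag)
    moreover have "0 \<le> kre (sesq n g (\<lambda>l. std_basis k l + (- kc_i) * y l) (\<lambda>l. std_basis k l + (- kc_i) * y l))"
      using g unfolding psd_def less_eq_kc_def by simp
    moreover have "kim (\<Sum>i<n. g k i * y i) = - c k k"
      using * by (simp add: y_def)
    ultimately show ?thesis
      unfolding sesq_add_smult l by simp
  qed
  let ?B = "mat n n (\<lambda>(j, k). kim (g j k))" and ?D = "mat n n (\<lambda>(l, k). 1 / d l * kim (g l k))"
  let ?E = "mat n n (\<lambda>(j, k). if j = k then 1 / d j else 0)"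
  have "mat n n (\<lambda>(j, k). c j k) = ?B\<^sup>T * (?E * ?B)"
    by (rule eq_matI) (auto simp: scalar_prod_def c_def atLeast0LessThan
        if_distrib[of "\<lambda>t. t * _"] cong: if_cong)
  moreover have "det (?B\<^sup>T * (?E * ?B)) = det ?B * (det ?E * det ?B)"
    using mult_carrier_mat[of ?E n n ?B n] det_mult[of "?B\<^sup>T" n "?E * ?B"] det_mult[of ?E n ?B] det_transpose[of ?B n] by simp
  moreover have "det ?E = (\<Prod>k<n. 1 / d k)"
    by (subst det_upper_triangular[of _ n]) (auto simp: prod_list_diag_prod atLeast0LessThan)
  ultimately have det_c: "det (mat n n (\<lambda>(j, k). c j k)) = (det ?B)\<^sup>2 / (\<Prod>k<n. d k)"
    by (simp add: prod_dividef power2_eq_square)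
  have "kc_of (det (mat n n (\<lambda>(j, k). c j k))) \<le> kc_of (\<Prod>k<n. c k k)"
    using hadamard(1)[OF c] unfolding det_kc_of kc_of_hom.hom_prod .
  then have "det (mat n n (\<lambda>(j, k). c j k)) \<le> (\<Prod>k<n. c k k)"
    unfolding kc_of_le_iff .
  also have "\<dots> \<le> (\<Prod>k<n. d k)"
    using c0 cd by (intro prod_mono) auto
  finally show "(det ?B)\<^sup>2 \<le> (\<Prod>k<n. d k)\<^sup>2"
    unfolding det_c using prod_pos[of "{..<n}" d] d by (simp add: divide_le_eq power2_eq_square)
qed

text \<open>
  A real null vector of the real part is a null vector of the form, hence by \<open>psd_null\<close> of the
  matrix \<open>f\<close>, and taking imaginary parts also of the imaginary part of \<open>f\<close>.
\<close>

lemma det_eq_0_of_det_kre_eq_0: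
  assumes f: "psd n f" and A: "det (mat n n (\<lambda>(j, k). kre (f j k))) = 0"
  shows "det (mat n n (\<lambda>(j, k). f j k)) = 0" and "det (mat n n (\<lambda>(j, k). kim (f j k))) = 0"
proof -
  obtain v where v: "v \<in> carrier_vec n" "v \<noteq> 0\<^sub>v n"
    and Av: "mat n n (\<lambda>(j, k). kre (f j k)) *\<^sub>v v = 0\<^sub>v n"
    using det_0_iff_vec_prod_zero_field[of "mat n n (\<lambda>(j, k). kre (f j k))" n] A by auto
  define x where "x j = (kc_of (v $ j) :: 'a kc)" for j
  have sum0: "(\<Sum>k<n. kre (f j k) * v $ k) = 0" if "j < n" for j
    using arg_cong[OF Av, of "\<lambda>w. w $ j"] that v(1) by (simp add: scalar_prod_def atLeast0LessThan)
  have "kre (sesq n f x x) = (\<Sum>j<n. v $ j * (\<Sum>k<n. kre (f j k) * v $ k))"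
    unfolding x_def by (simp add: sesq_kc_of sum_distrib_left mult.assoc)
  also have "\<dots> = 0" using sum0 by simp
  finally have "sesq n f x x = 0"
    using f by (simp add: psd_def less_eq_kc_def kc_eq_iff)
  then have fx: "(\<Sum>k<n. f j k * x k) = 0" if "j < n" for j
    using psd_null[OF f, of x "std_basis j"] that by (simp add: sesq_std_basis_left)
  have "mat n n (\<lambda>(j, k). kim (f j k)) *\<^sub>v v = 0\<^sub>v n"
    using v(1) fx by (intro eq_vecI)
      (auto simp: scalar_prod_def atLeast0LessThan x_def kc_eq_iff)
  then show "det (mat n n (\<lambda>(j, k). kim (f j k))) = 0"
    using v det_0_iff_vec_prod_zero_field[of "mat n n (\<lambda>(j, k). kim (f j k))" n] by auto
  have "vec n x \<noteq> 0\<^sub>v n"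
    using v by (auto simp: x_def vec_eq_iff kc_eq_iff)
  moreover have "mat n n (\<lambda>(j, k). f j k) *\<^sub>v vec n x = 0\<^sub>v n"
    using fx by (intro eq_vecI) (auto simp: scalar_prod_def atLeast0LessThan)
  ultimately show "det (mat n n (\<lambda>(j, k). f j k)) = 0"
    using det_0_iff_vec_prod_zero_field[of "mat n n (\<lambda>(j, k). f j k)" n]
    by (metis mat_carrier vec_carrier)
qed

text \<open>
  Reduction to \<open>det_bounds_of_diagonal_kre\<close>: with \<open>A = U\<^sup>T D U\<close> and \<open>P = U\<^sup>-\<^sup>1\<close> one has
  \<open>P\<^sup>T A P = D\<close>. As \<open>P\<close> is real of determinant 1, the congruence by \<open>P\<close> acts separately on real and
  imaginary parts and preserves all determinants.
\<close>

lemma det_bounds_of_det_kre_nonzero: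
  assumes f: "psd n f" and A: "det (mat n n (\<lambda>(j, k). kre (f j k))) \<noteq> 0"
  shows "det (mat n n (\<lambda>(j, k). f j k)) \<le> kc_of (det (mat n n (\<lambda>(j, k). kre (f j k))))"
    and "det (mat n n (\<lambda>(j, k). f j k)) = kc_of (det (mat n n (\<lambda>(j, k). kre (f j k)))) \<Longrightarrow>
      j < n \<Longrightarrow> k < n \<Longrightarrow> kim (f j k) = 0"
    and "(det (mat n n (\<lambda>(j, k). kim (f j k))))\<^sup>2 \<le> (det (mat n n (\<lambda>(j, k). kre (f j k))))\<^sup>2"
proof -
  define A where "A = mat n n (\<lambda>(j, k). kre (f j k))"
  define B where "B = mat n n (\<lambda>(j, k). kim (f j k))"
  define F where "F = mat n n (\<lambda>(j, k). f j k)"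
  have [simp]: "A \<in> carrier_mat n n" "B \<in> carrier_mat n n" "F \<in> carrier_mat n n"
    by (simp_all add: A_def B_def F_def)
  note [simp] = mult_carrier_mat[of _ n n _ n]
  obtain d v where d: "\<And>l. l < n \<Longrightarrow> 0 \<le> d l"
    and v1: "\<And>l. l < n \<Longrightarrow> v l l = 1" and v0: "\<And>l k. l < n \<Longrightarrow> k < l \<Longrightarrow> v l k = 0"
    and fv: "\<And>j k. j < n \<Longrightarrow> k < n \<Longrightarrow>
      kc_of (kre (f j k)) = (\<Sum>l<n. conjugate (v l j) * kc_of (d l) * v l k)"
    and v_re: "\<And>l k. (\<And>j k. j < n \<Longrightarrow> k < n \<Longrightarrow> kim (kc_of (kre (f j k))) = 0) \<Longrightarrow>
      l < n \<Longrightarrow> k < n \<Longrightarrow> kim (v l k) = 0"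
    by (rule psd_LDL[OF psd_kre[OF f]]) blast
  have v_im: "kim (v l k) = 0" if "l < n" "k < n" for l k
    by (rule v_re[OF _ that]) simp
  define u where "u l k = kre (v l k)" for l k
  have au: "kre (f j k) = (\<Sum>l<n. u l j * d l * u l k)" if "j < n" "k < n" for j k
    using arg_cong[OF fv[OF that], of kre] that by (simp add: u_def v_im)
  define U where "U = mat n n (\<lambda>(l, k). u l k)"
  define D where "D = mat n n (\<lambda>(l, k). if l = k then d l else 0)"
  have [simp]: "U \<in> carrier_mat n n" "D \<in> carrier_mat n n"
    by (simp_all add: U_def D_def)
  have det_A: "det A = (\<Prod>l<n. d l)"
    unfolding A_def by (rule det_LDL[where u = u and v = u]) (auto simp: v1 v0 u_def au)
  have d_pos: "0 < d l" if "l < n" for l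
    using A d[OF that] that by (auto simp: det_A A_def[symmetric] order_less_le)
  have det_U: "det U = 1"
    by (subst det_upper_triangular[of _ n])
      (auto simp: U_def u_def v0 v1 prod_list_diag_prod)
  have AU: "A = U\<^sup>T * (D * U)"
    by (rule eq_matI) (auto simp: A_def U_def D_def au scalar_prod_def atLeast0LessThan
        if_distrib[of "\<lambda>t. t * _"] mult.assoc cong: if_cong)
  \<comment> \<open>the adjugate is the inverse of \<open>U\<close>, because \<open>det U = 1\<close>\<close>
  define P where "P = adj_mat U"
  have "(1 :: 'a) \<cdot>\<^sub>m 1\<^sub>m n = 1\<^sub>m n"
    by (intro eq_matI) auto
  then have [simp]: "P \<in> carrier_mat n n" and UP: "U * P = 1\<^sub>m n" and PU: "P * U = 1\<^sub>m n"
    using adj_mat[of U n] by (simp_all add: P_def det_U)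
  have det_P: "det P = 1"
    using det_mult[of U n P] UP by (simp add: det_U)
  have UTP: "P\<^sup>T * U\<^sup>T = 1\<^sub>m n" and PTU: "U\<^sup>T * P\<^sup>T = 1\<^sub>m n"
    by (simp_all add: transpose_mult[of _ n n _ n, symmetric] UP PU)
  have cancel: "P\<^sup>T * (U\<^sup>T * M) = M" "U\<^sup>T * (P\<^sup>T * M) = M" if "M \<in> carrier_mat n n" for M
    using that UTP PTU assoc_mult_mat[of "P\<^sup>T" n n "U\<^sup>T" n M n]
      assoc_mult_mat[of "U\<^sup>T" n n "P\<^sup>T" n M n] by auto
  have PAP: "P\<^sup>T * (A * P) = D"
    by (simp add: AU assoc_mult_mat[of _ n n _ n _ n] cancel UP right_mult_one_mat[of _ n n])
  define g where
    "g j k = sesq n f (\<lambda>l. kc_of (P $$ (l, j))) (\<lambda>l. kc_of (P $$ (l, k)))" for j k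
  have g: "psd n g"
    unfolding g_def by (rule psd_gram[OF f])
  have kre_g: "mat n n (\<lambda>(j, k). kre (g j k)) = P\<^sup>T * (A * P)"
    unfolding g_def sesq_kc_of A_def kc.sel by (rule congruence_mat) simp
  have kim_g: "mat n n (\<lambda>(j, k). kim (g j k)) = P\<^sup>T * (B * P)"
    unfolding g_def sesq_kc_of B_def kc.sel by (rule congruence_mat) simp
  define Q where "Q = map_mat (kc_of :: 'a \<Rightarrow> 'a kc) P"
  have [simp]: "Q \<in> carrier_mat n n" by (simp add: Q_def)
  have "mat n n (\<lambda>(j, k). g j k) = mat n n (\<lambda>(j, k). \<Sum>l<n. \<Sum>i<n. Q $$ (l, j) * f l i * Q $$ (i, k))"
    using carrier_matD[of P n n]
    by (intro eq_matI) (auto simp: g_def sesq_def Q_def kc_eq_iff)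
  also have "\<dots> = Q\<^sup>T * (F * Q)"
    unfolding F_def by (rule congruence_mat) simp
  finally have "det (mat n n (\<lambda>(j, k). g j k)) = det F * (det Q)\<^sup>2"
    by (simp add: det_mult[of _ n] det_transpose[of _ n] power2_eq_square)
  then have det_g: "det (mat n n (\<lambda>(j, k). g j k)) = det F"
    by (simp add: Q_def det_P)
  have det_kim_g: "det (mat n n (\<lambda>(j, k). kim (g j k))) = det B"
    by (simp add: kim_g det_mult[of _ n] det_transpose[of _ n] det_P)
  have re: "kre (g j k) = (if j = k then d j else 0)" if "j < n" "k < n" for j k
    using arg_cong[OF kre_g, of "\<lambda>M. M $$ (j, k)"] that by (simp add: PAP D_def)
  note diag = det_bounds_of_diagonal_kre[OF g re d_pos]
  show "det (mat n n (\<lambda>(j, k). f j k)) \<le> kc_of (det (mat n n (\<lambda>(j, k). kre (f j k))))"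
    using diag(1) unfolding A_def[symmetric] F_def[symmetric] det_g det_A .
  show "(det (mat n n (\<lambda>(j, k). kim (f j k))))\<^sup>2 \<le> (det (mat n n (\<lambda>(j, k). kre (f j k))))\<^sup>2"
    using diag(3) unfolding A_def[symmetric] B_def[symmetric] det_kim_g det_A .
  assume eq: "det (mat n n (\<lambda>(j, k). f j k)) = kc_of (det (mat n n (\<lambda>(j, k). kre (f j k))))"
    and j: "j < n" and k: "k < n"
  have eq': "det (mat n n (\<lambda>(j, k). g j k)) = kc_of (\<Prod>l<n. d l)"
    using eq unfolding A_def[symmetric] F_def[symmetric] det_g det_A .
  have "kim (g i l) = 0" if "i < n" "l < n" for i l
    using diag(2) eq' that by blast
  then have "mat n n (\<lambda>(j, k). kim (g j k)) = 0\<^sub>m n n"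
    by (intro eq_matI) auto
  then have "P\<^sup>T * (B * P) = 0\<^sub>m n n"
    using kim_g by simp
  then have "U\<^sup>T * (P\<^sup>T * (B * P)) * U = 0\<^sub>m n n"
    by (simp add: right_mult_zero_mat[of _ n n] left_mult_zero_mat[of _ n n])
  then have "B = 0\<^sub>m n n"
    by (simp add: cancel assoc_mult_mat[of _ n n _ n _ n] UP PU right_mult_one_mat[of _ n n])
  then have "B $$ (j, k) = 0" using j k by simp
  then show "kim (f j k) = 0" using j k by (simp add: B_def)
qed

lemma psd_det:
  assumes f: "psd n f"
  shows "kc_of (det (mat n n (\<lambda>(j, k). kre (f j k)))) \<le> (\<Prod>k<n. f k k)"
    and "det (mat n n (\<lambda>(j, k). f j k)) \<le> kc_of (det (mat n n (\<lambda>(j, k). kre (f j k))))"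
    and "det (mat n n (\<lambda>(j, k). kim (f j k))) \<le> det (mat n n (\<lambda>(j, k). kre (f j k)))"
proof -
  note had = hadamard[OF psd_kre[OF f], unfolded det_kc_of]
  have "f k k = kc_of (kre (f k k))" if "k < n" for k
    using psd_hermitian[OF f that that] by (auto simp: kc_eq_iff)
  then have "(\<Prod>k<n. f k k) = (\<Prod>k<n. kc_of (kre (f k k)))"
    by (intro prod.cong) auto
  then show "kc_of (det (mat n n (\<lambda>(j, k). kre (f j k)))) \<le> (\<Prod>k<n. f k k)"
    using had(1) by simp
  have nonneg: "0 \<le> det (mat n n (\<lambda>(j, k). kre (f j k)))"
    using had(2) by (simp add: less_eq_kc_def)
  show "det (mat n n (\<lambda>(j, k). f j k)) \<le> kc_of (det (mat n n (\<lambda>(j, k). kre (f j k))))"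
    using det_eq_0_of_det_kre_eq_0(1)[OF f] det_bounds_of_det_kre_nonzero(1)[OF f] by fastforce
  show "det (mat n n (\<lambda>(j, k). kim (f j k))) \<le> det (mat n n (\<lambda>(j, k). kre (f j k)))"
  proof (cases "det (mat n n (\<lambda>(j, k). kre (f j k))) = 0")
    case True
    then show ?thesis using det_eq_0_of_det_kre_eq_0(2)[OF f] by simp
  next
    case False
    show ?thesis
      by (rule power2_le_imp_le[OF det_bounds_of_det_kre_nonzero(3)[OF f False] nonneg])
  qed
qed

section \<open>The equality cases\<close>

lemma det_diagonal_mat:
  assumes "A \<in> carrier_mat n n" "diagonal_mat A"
  shows "det A = (\<Prod>k<n. A $$ (k, k))"
  using assms by (subst det_upper_triangular[of _ n])
    (auto simp: diagonal_mat_def prod_list_diag_prod atLeast0LessThan)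

text \<open>
  A vanishing diagonal entry collapses the chain \<open>0 \<le> det f \<le> det A \<le> \<Prod> f k k = 0\<close>.
\<close>

lemma psd_det_zero_diagonal:
  assumes f: "psd n f" and k: "k < n" "f k k = 0"
  shows "(\<Prod>k<n. f k k) = 0" and "det (mat n n (\<lambda>(j, k). f j k)) = 0"
    and "det (mat n n (\<lambda>(j, k). kre (f j k))) = 0"
    and "det (mat n n (\<lambda>(j, k). kim (f j k))) = 0"
proof -
  show prod: "(\<Prod>k<n. f k k) = 0" using k by auto
  have "kc_of (det (mat n n (\<lambda>(j, k). kre (f j k)))) = 0"
  proof (rule antisym)
    show "kc_of (det (mat n n (\<lambda>(j, k). kre (f j k)))) \<le> 0"
      using psd_det(1)[OF f] unfolding prod .
    show "0 \<le> kc_of (det (mat n n (\<lambda>(j, k). kre (f j k))))"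
      by (rule order_trans[OF hadamard(2)[OF f] psd_det(2)[OF f]])
  qed
  then show A: "det (mat n n (\<lambda>(j, k). kre (f j k))) = 0"
    by (simp only: kc_eq_iff kc_of_simps kre_simps)
  show "det (mat n n (\<lambda>(j, k). f j k)) = 0" "det (mat n n (\<lambda>(j, k). kim (f j k))) = 0"
    using det_eq_0_of_det_kre_eq_0[OF f A] by simp_all
qed

lemma det_kre_eq_prod_iff:
  assumes f: "psd n f" and nz: "\<And>k. k < n \<Longrightarrow> f k k \<noteq> 0"
  shows "(\<Prod>k<n. f k k) = kc_of (det (mat n n (\<lambda>(j, k). kre (f j k)))) \<longleftrightarrow>
    diagonal_mat (mat n n (\<lambda>(j, k). kre (f j k)))"
proof -
  have fkk: "f k k = kc_of (kre (f k k))" if "k < n" for k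
    using psd_hermitian[OF f that that] by (auto simp: kc_eq_iff)
  have prod: "(\<Prod>k<n. f k k) = (\<Prod>k<n. kc_of (kre (f k k)))"
    using fkk by (intro prod.cong) auto
  show ?thesis
  proof
    assume "(\<Prod>k<n. f k k) = kc_of (det (mat n n (\<lambda>(j, k). kre (f j k))))"
    then have "det (mat n n (\<lambda>(j, k). kc_of (kre (f j k)))) = (\<Prod>k<n. kc_of (kre (f k k)))"
      by (simp only: prod det_kc_of)
    moreover have "kc_of (kre (f k k)) \<noteq> 0" if "k < n" for k
      using nz[OF that] fkk[OF that] by simp
    ultimately have "kc_of (kre (f j k)) = 0" if "j < n" "k < n" "j \<noteq> k" for j k
      using hadamard(3)[OF psd_kre[OF f] _ _ that] by blast
    then show "diagonal_mat (mat n n (\<lambda>(j, k). kre (f j k)))"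
      by (simp add: diagonal_mat_def kc_eq_iff)
  next
    assume "diagonal_mat (mat n n (\<lambda>(j, k). kre (f j k)))"
    then have "det (mat n n (\<lambda>(j, k). kre (f j k))) = (\<Prod>k<n. kre (f k k))"
      using det_diagonal_mat[of "mat n n (\<lambda>(j, k). kre (f j k))" n] by simp
    then show "(\<Prod>k<n. f k k) = kc_of (det (mat n n (\<lambda>(j, k). kre (f j k))))"
      by (simp add: prod kc_of_hom.hom_prod)
  qed
qed

section \<open>Hermitian forms\<close>

text \<open>
  The form of the Gram matrix at \<open>x\<close> is the value of \<open>\<phi>\<close> at the vector \<open>\<Sum> x k e\<^sub>k\<close>. Conjugate
  linearity in the first argument is obtained from linearity in the second by symmetry.
\<close>

lemma psd_of_hermitian_form:
  fixes scale :: "'k::linordered_field kc \<Rightarrow> 'v::ab_group_add \<Rightarrow> 'v"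
  assumes "hermitian_form scale \<phi>" and "nonneg_definite \<phi>"
  shows "psd n (\<lambda>j k. \<phi> (e j) (e k))"
proof (rule psdI)
  have conj: "conjugate (\<phi> v w) = \<phi> w v" for v w
    using assms(1) by (simp add: hermitian_form_def)
  show "conjugate (\<phi> (e j) (e k)) = \<phi> (e k) (e j)" for j k
    by (rule conj)
  fix x
  define v where "v = (\<Sum>k<n. scale (x k) (e k))"
  have right: "\<phi> w v = (\<Sum>k<n. x k * \<phi> w (e k))" for w
  proof -
    interpret Vector_Spaces.linear scale "(*)" "\<phi> w"
      using assms(1) by (simp add: hermitian_form_def)
    show ?thesis by (simp add: v_def sum scale)
  qed
  have left: "\<phi> v w = (\<Sum>j<n. conjugate (x j) * \<phi> (e j) w)" for w
    using arg_cong[OF right[of w], of conjugate]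
    by (simp add: conj sum_conjugate conjugate_dist_mul)
  have "\<phi> v v = (\<Sum>j<n. conjugate (x j) * \<phi> (e j) v)"
    by (rule left)
  also have "\<dots> = sesq n (\<lambda>j k. \<phi> (e j) (e k)) x x"
    by (simp add: right sesq_def sum_distrib_left mult_ac)
  finally show "0 \<le> kre (sesq n (\<lambda>j k. \<phi> (e j) (e k)) x x)"
    using assms(2) unfolding nonneg_definite_def less_eq_kc_def
    by (metis kre_simps(1))
qed

theorem theorem4p2:
  fixes scale :: "'k::linordered_field kc \<Rightarrow> 'v::ab_group_add \<Rightarrow> 'v"
    and n :: nat
    and e :: "nat \<Rightarrow> 'v"
    and \<phi> :: "'v \<Rightarrow> 'v \<Rightarrow> 'k kc"
    and a b :: "nat \<Rightarrow> nat \<Rightarrow> 'k"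
    and \<Phi> :: "'k kc mat"
    and A B :: "'k mat"
  assumes "vector_space scale"
    and "vector_space.ordered_basis scale n e"
    and "hermitian_form scale \<phi>"
    and "nonneg_definite \<phi>"
    and "\<And>j k. j < n \<Longrightarrow> k < n \<Longrightarrow> \<phi> (e j) (e k) = kc_of (a j k) + kc_i * kc_of (b j k)"
    and "\<Phi> = mat n n (\<lambda>(j, k). \<phi> (e j) (e k))"
    and "A = mat n n (\<lambda>(j, k). a j k)"
    and "B = mat n n (\<lambda>(j, k). b j k)"
  shows "((\<Prod>k<n. \<phi> (e k) (e k)) \<ge> kc_of (det A) \<and> kc_of (det A) \<ge> det \<Phi> \<and>
          (\<Prod>k<n. \<phi> (e k) (e k)) \<ge> kc_of (det A) \<and> det A \<ge> det B) \<and>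
         (((\<Prod>k<n. \<phi> (e k) (e k)) = kc_of (det A) \<and> kc_of (det A) = det \<Phi>) \<longleftrightarrow>
          ((\<exists>k<n. \<phi> (e k) (e k) = 0) \<or> (\<Phi> = map_mat kc_of A \<and> diagonal_mat A))) \<and>
         ((\<Prod>k<n. \<phi> (e k) (e k)) = kc_of (det B) \<longleftrightarrow>
          ((\<exists>k<n. \<phi> (e k) (e k) = 0) \<or> (diagonal_mat A \<and> det B = det A)))"
proof -
  define f where "f j k = \<phi> (e j) (e k)" for j k
  have f: "psd n f"
    unfolding f_def by (rule psd_of_hermitian_form[OF assms(3,4)])
  have ab: "kre (f j k) = a j k" "kim (f j k) = b j k" if "j < n" "k < n" for j k
    using assms(5)[OF that] by (simp_all add: f_def)
  have \<Phi>: "\<Phi> = mat n n (\<lambda>(j, k). f j k)"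
    unfolding assms(6) f_def ..
  have A: "A = mat n n (\<lambda>(j, k). kre (f j k))" and B: "B = mat n n (\<lambda>(j, k). kim (f j k))"
    unfolding assms(7,8) by (auto simp: ab intro!: eq_matI)
  have prod: "(\<Prod>k<n. \<phi> (e k) (e k)) = (\<Prod>k<n. f k k)"
    by (simp add: f_def)
  have real_iff: "\<Phi> = map_mat kc_of A \<longleftrightarrow> (\<forall>j<n. \<forall>k<n. kim (f j k) = 0)"
    unfolding \<Phi> A by (auto simp: mat_eq_iff kc_eq_iff)
  note i = psd_det[OF f, folded \<Phi> A B]
  note zero = psd_det_zero_diagonal[OF f, folded \<Phi> A B]
  have ii: "(\<Prod>k<n. f k k) = kc_of (det A) \<and> kc_of (det A) = det \<Phi> \<longleftrightarrow>
      (\<exists>k<n. f k k = 0) \<or> (\<Phi> = map_mat kc_of A \<and> diagonal_mat A)"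
  proof (cases "\<exists>k<n. f k k = 0")
    case True
    then show ?thesis using zero by auto
  next
    case False
    then have iff: "(\<Prod>k<n. f k k) = kc_of (det A) \<longleftrightarrow> diagonal_mat A"
      unfolding A by (intro det_kre_eq_prod_iff[OF f]) auto
    have "\<Phi> = map_mat kc_of A"
      if "(\<Prod>k<n. f k k) = kc_of (det A)" "kc_of (det A) = det \<Phi>"
    proof -
      have "(\<Prod>k<n. f k k) \<noteq> 0" using False by auto
      then have "det A \<noteq> 0" using that by auto
      then show ?thesis
        using det_bounds_of_det_kre_nonzero(2)[OF f, folded \<Phi> A] that(2) real_iff by auto
    qed
    moreover have "kc_of (det A) = det \<Phi>" if "\<Phi> = map_mat kc_of A"
      by (simp add: that)
    ultimately show ?thesis
      using False iff by blast
  qed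
  have iii: "(\<Prod>k<n. f k k) = kc_of (det B) \<longleftrightarrow>
      (\<exists>k<n. f k k = 0) \<or> (diagonal_mat A \<and> det B = det A)"
  proof (cases "\<exists>k<n. f k k = 0")
    case True
    then show ?thesis using zero by auto
  next
    case False
    then have iff: "(\<Prod>k<n. f k k) = kc_of (det A) \<longleftrightarrow> diagonal_mat A"
      unfolding A by (intro det_kre_eq_prod_iff[OF f]) auto
    have "det B = det A" if "(\<Prod>k<n. f k k) = kc_of (det B)"
    proof (rule antisym[OF i(3)])
      show "det A \<le> det B" using i(1) unfolding that kc_of_le_iff .
    qed
    then show ?thesis
      using False iff by metis
  qed
  show ?thesis
    using i ii iii unfolding prod by (simp add: f_def)
qed

end
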